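(* Let $f:(X,x_{0})\to(Y,y_{0})$ be a quotient map of pointed topological spaces, where $X$ is locally path-connected and $Y$ is semilocally simply-connected. If each fiber $f^{-1}(y)$, $y\in Y$, is connected, then the induced homomorphism $f_{\sharp}:\pi_{1}(X,x_{0})\to\pi_{1}(Y,y_{0})$ is surjective.
   Context: A map is a continuous function. No separation axioms (e.g. Hausdorff) are assumed, and neither $X$ nor $Y$ is required to be path-connected. A space $Z$ is semilocally simply-connected if each $z\in Z$ has a neighborhood $U$ such that the homomorphism $\pi_{1}(U,z)\to\pi_{1}(Z,z)$ induced by inclusion is trivial. The notation $f:(X,x_0)\to(Y,y_0)$ means $f:X\to Y$ with $f(x_0)=y_0$. A quotient map is in particular surjective. *)

theory Defs
  imports "HOL-Analysis.Analysis" "HOL-Algebra.Coset"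
begin

section \<open>Based loops and homotopy relative to the base point\<close>

definition loop_at :: "'a topology \<Rightarrow> 'a \<Rightarrow> (real \<Rightarrow> 'a) \<Rightarrow> bool"
  where "loop_at X x p \<longleftrightarrow> pathin X p \<and> p 0 = x \<and> p 1 = x"

definition loop_homotopic :: "'a topology \<Rightarrow> 'a \<Rightarrow> (real \<Rightarrow> 'a) \<Rightarrow> (real \<Rightarrow> 'a) \<Rightarrow> bool"
  where "loop_homotopic X x p q \<longleftrightarrow>
    homotopic_with (\<lambda>r. r 0 = x \<and> r 1 = x) (top_of_set {0..1}) X p q"

text \<open>The library's \<open>joinpaths\<close> has the same formula, but needs a topological type class on
  the codomain.\<close>

definition loop_concat :: "(real \<Rightarrow> 'a) \<Rightarrow> (real \<Rightarrow> 'a) \<Rightarrow> real \<Rightarrow> 'a"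
  where "loop_concat p q = (\<lambda>t. if t \<le> 1/2 then p (2 * t) else q (2 * t - 1))"

text \<open>Loops are total functions on \<open>real\<close>, but only the values on the unit interval matter:
  loops that agree there are homotopic and so lie in the same class.\<close>

definition loop_class :: "'a topology \<Rightarrow> 'a \<Rightarrow> (real \<Rightarrow> 'a) \<Rightarrow> (real \<Rightarrow> 'a) set"
  where "loop_class X x p = {q. loop_homotopic X x p q}"

section \<open>The fundamental group\<close>

text \<open>Operations on classes are unions over all representatives. By the lemmas
  \<open>fundamental_group_mult_class\<close> and \<open>fundamental_group_map_class\<close> below, all members of such
  a union are equal.\<close>

definition fundamental_group :: "'a topology \<Rightarrow> 'a \<Rightarrow> (real \<Rightarrow> 'a) set monoid"
  where "fundamental_group X x =
    \<lparr>carrier = loop_class X x ` {p. loop_at X x p},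
     mult = (\<lambda>A B. \<Union>p\<in>A. \<Union>q\<in>B. loop_class X x (loop_concat p q)),
     one = loop_class X x (\<lambda>_. x)\<rparr>"

text \<open>The map induced by a map \<open>f\<close> into the pointed space \<open>(Y, y)\<close>.\<close>

definition fundamental_group_map ::
    "'b topology \<Rightarrow> 'b \<Rightarrow> ('a \<Rightarrow> 'b) \<Rightarrow> (real \<Rightarrow> 'a) set \<Rightarrow> (real \<Rightarrow> 'b) set"
  where "fundamental_group_map Y y f A = (\<Union>p\<in>A. loop_class Y y (f \<circ> p))"

text \<open>Neighbourhoods need not be open.\<close>

definition semilocally_simply_connected :: "'a topology \<Rightarrow> bool"
  where "semilocally_simply_connected Z \<longleftrightarrow>
    (\<forall>z \<in> topspace Z. \<exists>U \<subseteq> topspace Z. z \<in> Z interior_of U \<and>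
       trivial_homomorphism (fundamental_group (subtopology Z U) z) (fundamental_group Z z)
         (fundamental_group_map Z z id))"

section \<open>Well-definedness\<close>

lemma loop_homotopic_alt:
  "loop_homotopic X x p q \<longleftrightarrow>
     (\<exists>h. continuous_map (prod_topology (top_of_set {0..1::real}) (top_of_set {0..1})) X h \<and>
        (\<forall>t\<in>{0..1}. h (0, t) = p t) \<and> (\<forall>t\<in>{0..1}. h (1, t) = q t) \<and>
        (\<forall>s\<in>{0..1}. h (s, 0) = x \<and> h (s, 1) = x))"
  unfolding loop_homotopic_def
  by (subst homotopic_with) (simp_all only: topspace_euclidean_subtopology, auto)

lemma loop_homotopic_imp_loop:
  assumes "loop_homotopic X x p q" shows "loop_at X x p" "loop_at X x q"
  using homotopic_with_imp_continuous_maps[OF assms[unfolded loop_homotopic_def]]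
    homotopic_with_imp_property[OF assms[unfolded loop_homotopic_def]]
  by (simp_all add: loop_at_def pathin_def)

lemma loop_homotopic_eq:
  assumes "loop_at X x p" "\<And>t. t \<in> {0..1} \<Longrightarrow> p t = q t"
  shows "loop_homotopic X x p q"
  using assms unfolding loop_homotopic_def loop_at_def pathin_def
  by (intro homotopic_with_equal) (auto simp: pathin_def)

lemma loop_homotopic_refl: "loop_at X x p \<Longrightarrow> loop_homotopic X x p p"
  by (rule loop_homotopic_eq) simp_all

lemma loop_homotopic_sym: "loop_homotopic X x p q \<Longrightarrow> loop_homotopic X x q p"
  unfolding loop_homotopic_def by (simp add: homotopic_with_sym)

lemma loop_homotopic_trans:
  "loop_homotopic X x p q \<Longrightarrow> loop_homotopic X x q r \<Longrightarrow> loop_homotopic X x p r"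
  unfolding loop_homotopic_def by (rule homotopic_with_trans)

lemma loop_class_eq: "loop_homotopic X x p q \<Longrightarrow> loop_class X x p = loop_class X x q"
  unfolding loop_class_def by (blast intro: loop_homotopic_sym loop_homotopic_trans)

lemma loop_class_eq_iff:
  assumes "loop_at X x p"
  shows "loop_class X x p = loop_class X x q \<longleftrightarrow> loop_homotopic X x p q"
  using assms loop_homotopic_refl loop_homotopic_sym loop_homotopic_imp_loop
  by (metis loop_class_eq loop_class_def mem_Collect_eq)

lemma loop_homotopic_concat:
  assumes "loop_homotopic X x p p'" "loop_homotopic X x q q'"
  shows "loop_homotopic X x (loop_concat p q) (loop_concat p' q')"
proof -
  let ?I = "top_of_set {0..1::real}"
  let ?S = "prod_topology ?I ?I"
  obtain h where h: "continuous_map ?S X h" "\<And>t. t\<in>{0..1} \<Longrightarrow> h (0, t) = p t"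
      "\<And>t. t\<in>{0..1} \<Longrightarrow> h (1, t) = p' t" "\<And>s. s\<in>{0..1} \<Longrightarrow> h (s, 0) = x \<and> h (s, 1) = x"
    using assms(1) unfolding loop_homotopic_alt by metis
  obtain k where k: "continuous_map ?S X k" "\<And>t. t\<in>{0..1} \<Longrightarrow> k (0, t) = q t"
      "\<And>t. t\<in>{0..1} \<Longrightarrow> k (1, t) = q' t" "\<And>s. s\<in>{0..1} \<Longrightarrow> k (s, 0) = x \<and> k (s, 1) = x"
    using assms(2) unfolding loop_homotopic_alt by metis
  have S: "?S = top_of_set ({0..1} \<times> {0..1})"
    by (simp add: prod_topology_subtopology flip: euclidean_product_topology)
       (simp add: subtopology_subtopology Times_Int_Times)
  let ?m = "\<lambda>z. if snd z \<le> 1/2 then (h \<circ> (\<lambda>z. (fst z, 2 * snd z))) z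
                  else (k \<circ> (\<lambda>z. (fst z, 2 * snd z - 1))) z"
  have "continuous_map ?S X ?m"
  proof (rule continuous_map_cases_le)
    show "continuous_map (subtopology ?S {z \<in> topspace ?S. snd z \<le> 1/2}) X
            (h \<circ> (\<lambda>z. (fst z, 2 * snd z)))"
      by (rule continuous_map_compose[OF _ h(1)])
         (auto simp: S subtopology_subtopology intro!: continuous_intros)
    show "continuous_map (subtopology ?S {z \<in> topspace ?S. 1/2 \<le> snd z}) X
            (k \<circ> (\<lambda>z. (fst z, 2 * snd z - 1)))"
      by (rule continuous_map_compose[OF _ k(1)])
         (auto simp: S subtopology_subtopology intro!: continuous_intros)
    show "(h \<circ> (\<lambda>z. (fst z, 2 * snd z))) z = (k \<circ> (\<lambda>z. (fst z, 2 * snd z - 1))) z"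
      if "z \<in> topspace ?S" "snd z = 1/2" for z
    proof -
      have "(fst z, 2 * snd z) = (fst z, 1)" "(fst z, 2 * snd z - 1) = (fst z, 0)"
        using that by simp_all
      moreover have "fst z \<in> {0..1}" using that by (auto simp: S)
      ultimately show ?thesis using h(4) k(4) unfolding o_def by metis
    qed
  qed (auto simp: S intro!: continuous_intros)
  then show ?thesis
    unfolding loop_homotopic_alt
  proof (intro exI[of _ ?m] conjI ballI)
    fix t :: real assume t: "t \<in> {0..1}"
    show "?m (0, t) = loop_concat p q t"
      using t by (simp add: loop_concat_def h(2) k(2))
    show "?m (1, t) = loop_concat p' q' t"
      using t by (simp add: loop_concat_def h(3) k(3))
    show "?m (t, 0) = x" "?m (t, 1) = x"
      using t h(4) k(4) by simp_all
  qed
qed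

lemma loop_concat_loop:
  "loop_at X x p \<Longrightarrow> loop_at X x q \<Longrightarrow> loop_at X x (loop_concat p q)"
  by (meson loop_homotopic_concat loop_homotopic_refl loop_homotopic_imp_loop(1))

lemma fundamental_group_mult_class:
  assumes "loop_at X x p" "loop_at X x q"
  shows "loop_class X x p \<otimes>\<^bsub>fundamental_group X x\<^esub> loop_class X x q
       = loop_class X x (loop_concat p q)"
proof -
  have "loop_class X x (loop_concat p' q') = loop_class X x (loop_concat p q)"
    if "p' \<in> loop_class X x p" "q' \<in> loop_class X x q" for p' q'
    using that loop_class_eq loop_homotopic_concat unfolding loop_class_def
    by (metis mem_Collect_eq)
  then have "(\<Union>p'\<in>loop_class X x p. \<Union>q'\<in>loop_class X x q. loop_class X x (loop_concat p' q'))
      = (\<Union>p'\<in>loop_class X x p. \<Union>q'\<in>loop_class X x q. loop_class X x (loop_concat p q))"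
    by (intro SUP_cong refl)
  moreover have "p \<in> loop_class X x p" "q \<in> loop_class X x q"
    using assms by (simp_all add: loop_class_def loop_homotopic_refl)
  ultimately show ?thesis
    by (auto simp add: fundamental_group_def)
qed

lemma loop_homotopic_compose:
  assumes "continuous_map X Y f" "loop_homotopic X x p q"
  shows "loop_homotopic Y (f x) (f \<circ> p) (f \<circ> q)"
  using assms(2) unfolding loop_homotopic_def
  by (rule homotopic_with_compose_continuous_map_left) (use assms(1) in auto)

lemma loop_at_compose:
  "continuous_map X Y f \<Longrightarrow> loop_at X x p \<Longrightarrow> loop_at Y (f x) (f \<circ> p)"
  by (meson loop_homotopic_compose loop_homotopic_refl loop_homotopic_imp_loop(1))

lemma fundamental_group_map_class:
  assumes "continuous_map X Y f" "loop_at X x p"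
  shows "fundamental_group_map Y (f x) f (loop_class X x p) = loop_class Y (f x) (f \<circ> p)"
proof -
  have "loop_class Y (f x) (f \<circ> p') = loop_class Y (f x) (f \<circ> p)"
    if "p' \<in> loop_class X x p" for p'
    using that loop_class_eq loop_homotopic_compose[OF assms(1)] unfolding loop_class_def
    by (metis mem_Collect_eq)
  then have "(\<Union>p'\<in>loop_class X x p. loop_class Y (f x) (f \<circ> p'))
      = (\<Union>p'\<in>loop_class X x p. loop_class Y (f x) (f \<circ> p))"
    by (intro SUP_cong refl)
  moreover have "p \<in> loop_class X x p"
    using assms by (simp add: loop_class_def loop_homotopic_refl)
  ultimately show ?thesis
    by (auto simp add: fundamental_group_map_def)
qed

lemma fundamental_group_map_hom:
  assumes "continuous_map X Y f"
  shows "fundamental_group_map Y (f x) f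
           \<in> hom (fundamental_group X x) (fundamental_group Y (f x))"
proof (rule homI)
  have car: "\<exists>p. loop_at X x p \<and> A = loop_class X x p"
    if "A \<in> carrier (fundamental_group X x)" for A
    using that by (auto simp: fundamental_group_def)
  fix A assume "A \<in> carrier (fundamental_group X x)"
  then obtain p where p: "loop_at X x p" "A = loop_class X x p" using car by blast
  then show "fundamental_group_map Y (f x) f A \<in> carrier (fundamental_group Y (f x))"
    using loop_at_compose[OF assms]
    by (auto simp: fundamental_group_map_class[OF assms] fundamental_group_def)
  fix B assume "B \<in> carrier (fundamental_group X x)"
  then obtain q where q: "loop_at X x q" "B = loop_class X x q" using car by blast
  have "f \<circ> loop_concat p q = loop_concat (f \<circ> p) (f \<circ> q)"
    by (auto simp: loop_concat_def)
  then show "fundamental_group_map Y (f x) f (A \<otimes>\<^bsub>fundamental_group X x\<^esub> B)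
      = fundamental_group_map Y (f x) f A
          \<otimes>\<^bsub>fundamental_group Y (f x)\<^esub> fundamental_group_map Y (f x) f B"
    using p q loop_at_compose[OF assms]
    by (simp add: fundamental_group_map_class[OF assms] fundamental_group_mult_class
        loop_concat_loop)
qed

section \<open>The group laws\<close>

lemma loop_homotopic_reparam:
  assumes p: "pathin X p"
    and u: "continuous_on {0..1} u" "u ` {0..1} \<subseteq> {0..1::real}"
    and v: "continuous_on {0..1} v" "v ` {0..1} \<subseteq> {0..1::real}"
    and uv: "u 0 = v 0" "u 1 = v 1" "p (u 0) = x" "p (u 1) = x"
    and q: "\<And>t. t \<in> {0..1} \<Longrightarrow> q t = p (u t)"
    and r: "\<And>t. t \<in> {0..1} \<Longrightarrow> r t = p (v t)"
  shows "loop_homotopic X x q r"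
proof -
  let ?I = "top_of_set {0..1::real}"
  let ?S = "prod_topology ?I ?I"
  have S: "?S = top_of_set ({0..1} \<times> {0..1})"
    by (simp add: prod_topology_subtopology flip: euclidean_product_topology)
       (simp add: subtopology_subtopology Times_Int_Times)
  let ?w = "\<lambda>z. (1 - fst z) * u (snd z) + fst z * v (snd z)"
  have "continuous_on ({0..1} \<times> {0..1}) ?w"
    by (intro continuous_intros continuous_on_compose2[OF u(1)] continuous_on_compose2[OF v(1)])
       auto
  moreover have "?w z \<in> {0..1}" if "z \<in> {0..1} \<times> {0..1}" for z
  proof -
    have z: "0 \<le> fst z" "fst z \<le> 1" "u (snd z) \<in> {0..1}" "v (snd z) \<in> {0..1}"
      using that u(2) v(2) by (auto simp: mem_Times_iff image_subset_iff)
    show ?thesis using convexD_alt[OF convex_real_interval(5) z(3,4,1,2)] by simp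
  qed
  ultimately have "continuous_map ?S ?I ?w"
    unfolding S by auto
  then have "continuous_map ?S X (p \<circ> ?w)"
    using p unfolding pathin_def by (rule continuous_map_compose)
  moreover have "(1 - s) * a + s * a = a" for s a :: real by (simp add: algebra_simps)
  ultimately show ?thesis
    unfolding loop_homotopic_alt
    by (intro exI[of _ "p \<circ> ?w"]) (use uv q r in \<open>auto simp: o_def\<close>)
qed

lemma loop_at_const: "x \<in> topspace X \<Longrightarrow> loop_at X x (\<lambda>_. x)"
  by (simp add: loop_at_def pathin_def)

lemma loop_at_reverse:
  assumes "loop_at X x p" shows "loop_at X x (\<lambda>t. p (1 - t))"
proof -
  have "continuous_map (top_of_set {0..1}) (top_of_set {0..1}) (\<lambda>t::real. 1 - t)"
    by (auto intro!: continuous_intros)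
  then have "pathin X (p \<circ> (\<lambda>t. 1 - t))"
    using assms unfolding loop_at_def pathin_def by (blast intro: continuous_map_compose)
  then show ?thesis using assms by (simp add: loop_at_def o_def)
qed

lemma loop_concat_assoc:
  assumes "loop_at X x p" "loop_at X x q" "loop_at X x r"
  shows "loop_homotopic X x (loop_concat (loop_concat p q) r) (loop_concat p (loop_concat q r))"
proof (rule loop_homotopic_reparam[where u = "\<lambda>t. min (2 * t) (min (t + 1/4) ((t + 1) / 2))"
      and v = "\<lambda>t. t" and p = "loop_concat p (loop_concat q r)"])
  let ?u = "\<lambda>t::real. min (2 * t) (min (t + 1/4) ((t + 1) / 2))"
  fix t :: real assume t: "t \<in> {0..1}"
  consider "t \<le> 1/4" | "1/4 < t" "t \<le> 1/2" | "1/2 < t" by linarith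
  then show "loop_concat (loop_concat p q) r t = loop_concat p (loop_concat q r) (?u t)"
  proof cases
    case 1
    then have "?u t = 2 * t" by (auto simp: min_def)
    then show ?thesis using 1 by (simp add: loop_concat_def)
  next
    case 2
    then have "?u t = t + 1/4" by (auto simp: min_def)
    then show ?thesis using 2 by (simp add: loop_concat_def algebra_simps)
  next
    case 3
    then have "?u t = (t + 1) / 2" by (auto simp: min_def)
    then have u: "\<not> ?u t \<le> 1/2" "\<not> 2 * ?u t - 1 \<le> 1/2" "2 * (2 * ?u t - 1) - 1 = 2 * t - 1"
      using 3 by (simp_all add: field_simps)
    have "loop_concat p (loop_concat q r) (?u t) = r (2 * (2 * ?u t - 1) - 1)"
      unfolding loop_concat_def using u(1,2) by (simp only: if_False)
    then show ?thesis using 3 unfolding u(3) by (simp add: loop_concat_def)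
  qed
next
  have "loop_at X x (loop_concat p (loop_concat q r))"
    using assms by (intro loop_concat_loop)
  then show "pathin X (loop_concat p (loop_concat q r))"
    "loop_concat p (loop_concat q r) (min (2 * 0) (min (0 + 1/4) ((0 + 1) / 2))) = x"
    "loop_concat p (loop_concat q r) (min (2 * 1) (min (1 + 1/4) ((1 + 1) / 2))) = x"
    by (simp_all add: loop_at_def)
  show "continuous_on {0..1} (\<lambda>t::real. min (2 * t) (min (t + 1/4) ((t + 1) / 2)))"
    by (intro continuous_intros) auto
  show "(\<lambda>t::real. min (2 * t) (min (t + 1/4) ((t + 1) / 2))) ` {0..1} \<subseteq> {0..1}"
    by (auto simp: min_le_iff_disj)
qed simp_all

lemma loop_concat_const_left:
  assumes "loop_at X x p"
  shows "loop_homotopic X x (loop_concat (\<lambda>_. x) p) p"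
proof (rule loop_homotopic_reparam[where u = "\<lambda>t. max 0 (2 * t - 1)" and v = "\<lambda>t. t" and p = p])
  show "loop_concat (\<lambda>_. x) p t = p (max 0 (2 * t - 1))" for t
    using assms
    by (cases "t \<le> 1/2") (simp_all add: loop_concat_def loop_at_def max_absorb1 max_absorb2)
qed (use assms in \<open>auto simp: loop_at_def intro!: continuous_intros\<close>)

lemma loop_concat_reverse_left:
  assumes "loop_at X x p"
  shows "loop_homotopic X x (loop_concat (\<lambda>t. p (1 - t)) p) (\<lambda>_. x)"
proof (rule loop_homotopic_reparam[where u = "\<lambda>t. max (1 - 2 * t) (2 * t - 1)"
      and v = "\<lambda>_. 1" and p = p])
  show "loop_concat (\<lambda>t. p (1 - t)) p t = p (max (1 - 2 * t) (2 * t - 1))" for t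
    by (cases "t \<le> 1/2") (simp_all add: loop_concat_def max_absorb1 max_absorb2)
qed (use assms in \<open>auto simp: loop_at_def intro!: continuous_intros\<close>)

lemma group_fundamental_group:
  assumes "x \<in> topspace X"
  shows "group (fundamental_group X x)"
proof (rule groupI)
  let ?G = "fundamental_group X x"
  have car: "\<exists>p. loop_at X x p \<and> A = loop_class X x p" if "A \<in> carrier ?G" for A
    using that by (auto simp: fundamental_group_def)
  have inc: "loop_class X x p \<in> carrier ?G" if "loop_at X x p" for p
    using that by (auto simp: fundamental_group_def)
  have one: "\<one>\<^bsub>?G\<^esub> = loop_class X x (\<lambda>_. x)" by (simp add: fundamental_group_def)
  note [simp] = fundamental_group_mult_class loop_concat_loop loop_at_const[OF assms]
  show "\<one>\<^bsub>?G\<^esub> \<in> carrier ?G"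
    unfolding one by (rule inc) simp
  fix A assume "A \<in> carrier ?G"
  then obtain p where p: "loop_at X x p" "A = loop_class X x p" using car by blast
  show "\<one>\<^bsub>?G\<^esub> \<otimes>\<^bsub>?G\<^esub> A = A"
    using p by (simp add: one loop_class_eq[OF loop_concat_const_left])
  show "\<exists>B\<in>carrier ?G. B \<otimes>\<^bsub>?G\<^esub> A = \<one>\<^bsub>?G\<^esub>"
    by (rule bexI[OF _ inc[OF loop_at_reverse[OF p(1)]]])
       (use p in \<open>simp add: one loop_at_reverse loop_class_eq[OF loop_concat_reverse_left]\<close>)
  fix B assume "B \<in> carrier ?G"
  then obtain q where q: "loop_at X x q" "B = loop_class X x q" using car by blast
  show "A \<otimes>\<^bsub>?G\<^esub> B \<in> carrier ?G"
    using p q by (simp add: inc)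
  fix C assume "C \<in> carrier ?G"
  then obtain r where r: "loop_at X x r" "C = loop_class X x r" using car by blast
  show "A \<otimes>\<^bsub>?G\<^esub> B \<otimes>\<^bsub>?G\<^esub> C = A \<otimes>\<^bsub>?G\<^esub> (B \<otimes>\<^bsub>?G\<^esub> C)"
    using p q r by (simp add: loop_class_eq[OF loop_concat_assoc])
qed

end

theory Submission
  imports Defs
begin

text \<open>By connectedness of the fibers, the components of the preimage of an open set are saturated,
  so every point of \<open>Y\<close> has arbitrarily small open neighbourhoods \<open>N\<close> with path-connected preimage.
  If loops in \<open>N\<close> contract in \<open>Y\<close>, a path in \<open>N\<close> is homotopic rel endpoints to the image of a
  path in \<open>X\<close> with arbitrarily prescribed endpoints over the given ones. Subdividing a loop in \<open>Y\<close>
  into such small pieces lifts it, up to homotopy, to a loop in \<open>X\<close>.\<close>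

section \<open>Lifting path segments up to homotopy rel endpoints\<close>

text \<open>The interval stays \<open>{a..b}\<close> instead of being rescaled to the unit interval,
  so that adjacent pieces can be glued and bisection applies directly. The first coordinate of
  \<open>h\<close> is the deformation parameter, the second the path parameter. Fixing both
  endpoints \<open>x\<close> and \<open>x'\<close> of the lift is what makes consecutive lifts fit
  together.\<close>

definition lifts_rel_endpoints ::
    "'a topology \<Rightarrow> 'b topology \<Rightarrow> ('a \<Rightarrow> 'b) \<Rightarrow> (real \<Rightarrow> 'b) \<Rightarrow> real \<Rightarrow> real \<Rightarrow> 'a \<Rightarrow> 'a \<Rightarrow> bool"
  where "lifts_rel_endpoints X Y f g a b x x' \<longleftrightarrow>
    (\<exists>\<alpha> h. continuous_map (top_of_set {a..b}) X \<alpha> \<and> \<alpha> a = x \<and> \<alpha> b = x' \<and>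
       continuous_map (top_of_set ({0..1::real} \<times> {a..b})) Y h \<and>
       (\<forall>t\<in>{a..b}. h (0, t) = g t \<and> h (1, t) = f (\<alpha> t)) \<and>
       (\<forall>s\<in>{0..1}. h (s, a) = g a \<and> h (s, b) = g b))"

text \<open>The lifts meet at \<open>x'\<close>, and the homotopies agree on the common edge because
  each is constantly \<open>g b\<close> there.\<close>

lemma lifts_rel_endpoints_trans:
  assumes "a \<le> b" "b \<le> c"
    and ab: "lifts_rel_endpoints X Y f g a b x x'"
    and bc: "lifts_rel_endpoints X Y f g b c x' x''"
  shows "lifts_rel_endpoints X Y f g a c x x''"
proof -
  obtain \<alpha> h where \<alpha>: "continuous_map (top_of_set {a..b}) X \<alpha>" "\<alpha> a = x" "\<alpha> b = x'"
    and h: "continuous_map (top_of_set ({0..1::real} \<times> {a..b})) Y h"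
      "\<And>t. t \<in> {a..b} \<Longrightarrow> h (0, t) = g t \<and> h (1, t) = f (\<alpha> t)"
      "\<And>s. s \<in> {0..1} \<Longrightarrow> h (s, a) = g a \<and> h (s, b) = g b"
    using ab unfolding lifts_rel_endpoints_def by blast
  obtain \<beta> k where \<beta>: "continuous_map (top_of_set {b..c}) X \<beta>" "\<beta> b = x'" "\<beta> c = x''"
    and k: "continuous_map (top_of_set ({0..1::real} \<times> {b..c})) Y k"
      "\<And>t. t \<in> {b..c} \<Longrightarrow> k (0, t) = g t \<and> k (1, t) = f (\<beta> t)"
      "\<And>s. s \<in> {0..1} \<Longrightarrow> k (s, b) = g b \<and> k (s, c) = g c"
    using bc unfolding lifts_rel_endpoints_def by blast
  let ?\<alpha> = "\<lambda>t. if t \<le> b then \<alpha> t else \<beta> t"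
  let ?h = "\<lambda>z. if snd z \<le> b then h z else k z"
  have "continuous_map (top_of_set {a..c}) X ?\<alpha>"
  proof (rule continuous_map_cases_le)
    let ?I = "top_of_set {a..c}"
    have "{a..c} \<inter> {t \<in> topspace ?I. t \<le> b} = {a..b}"
      "{a..c} \<inter> {t \<in> topspace ?I. b \<le> t} = {b..c}"
      using assms(1,2) by auto
    then show "continuous_map (subtopology ?I {t \<in> topspace ?I. t \<le> b}) X \<alpha>"
      "continuous_map (subtopology ?I {t \<in> topspace ?I. b \<le> t}) X \<beta>"
      using \<alpha>(1) \<beta>(1) by (simp_all only: subtopology_subtopology)
  qed (auto simp: \<alpha> \<beta> intro!: continuous_intros)
  moreover have "continuous_map (top_of_set ({0..1::real} \<times> {a..c})) Y ?h"
  proof (rule continuous_map_cases_le)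
    let ?S = "top_of_set ({0..1::real} \<times> {a..c})"
    have "({0..1::real} \<times> {a..c}) \<inter> {z \<in> topspace ?S. snd z \<le> b} = {0..1::real} \<times> {a..b}"
      "({0..1::real} \<times> {a..c}) \<inter> {z \<in> topspace ?S. b \<le> snd z} = {0..1::real} \<times> {b..c}"
      using assms(1,2) by auto
    then show "continuous_map (subtopology ?S {z \<in> topspace ?S. snd z \<le> b}) Y h"
      "continuous_map (subtopology ?S {z \<in> topspace ?S. b \<le> snd z}) Y k"
      using h(1) k(1) by (simp_all only: subtopology_subtopology)
    show "h z = k z" if "z \<in> topspace ?S" "snd z = b" for z
      using that h(3)[of "fst z"] k(3)[of "fst z"] by (cases z) auto
  qed (auto intro!: continuous_intros)
  moreover have "?\<alpha> a = x" "?\<alpha> c = x''"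
    using assms(1,2) \<alpha> \<beta> by auto
  moreover have "\<forall>t\<in>{a..c}. ?h (0, t) = g t \<and> ?h (1, t) = f (?\<alpha> t)"
    using h(2) k(2) by auto
  moreover have "\<forall>s\<in>{0..1}. ?h (s, a) = g a \<and> ?h (s, c) = g c"
    using assms(1,2) h(3) k(3) by auto
  ultimately show ?thesis
    unfolding lifts_rel_endpoints_def by blast
qed

section \<open>From contractible loops to homotopies of paths\<close>

text \<open>The neighbourhood \<open>U\<close> of the definition may be replaced by its interior: a
  loop in the interior is a loop in \<open>U\<close>, and its class in \<open>Y\<close> is the image
  of its class in \<open>U\<close>, hence trivial.\<close>

lemma semilocally_simply_connected_nullhomotopic:
  assumes "semilocally_simply_connected Y" "y \<in> topspace Y"
  obtains W where "openin Y W" "y \<in> W"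
    "\<And>p. loop_at (subtopology Y W) y p \<Longrightarrow> loop_homotopic Y y p (\<lambda>_. y)"
proof -
  obtain U where U: "U \<subseteq> topspace Y" "y \<in> Y interior_of U"
    and triv: "trivial_homomorphism (fundamental_group (subtopology Y U) y) (fundamental_group Y y)
         (fundamental_group_map Y y id)"
    using assms unfolding semilocally_simply_connected_def by meson
  show thesis
  proof
    show "openin Y (Y interior_of U)" "y \<in> Y interior_of U"
      using U by auto
    fix p assume "loop_at (subtopology Y (Y interior_of U)) y p"
    then have p: "loop_at (subtopology Y U) y p" "loop_at Y y p"
      using interior_of_subset[of Y U]
      by (auto simp: loop_at_def pathin_def continuous_map_in_subtopology)
    have "loop_class Y y p = fundamental_group_map Y y id (loop_class (subtopology Y U) y p)"
      using fundamental_group_map_class[OF continuous_map_from_subtopology[OF continuous_map_id] p(1)]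
      by simp
    also have "\<dots> = loop_class Y y (\<lambda>_. y)"
      using triv p(1) by (auto simp: trivial_homomorphism_def fundamental_group_def)
    finally show "loop_homotopic Y y p (\<lambda>_. y)"
      using loop_class_eq_iff[OF p(2)] by blast
  qed
qed

text \<open>A contraction of the loop that runs out along \<open>q\<close> and back along
  \<open>p\<close> is a map of the square that is constantly \<open>y\<close> on three sides.
  Sweeping the square by segments ending in the middle of the fourth side turns it into a homotopy
  from \<open>p\<close> to \<open>q\<close> rel endpoints. That \<open>p\<close> and
  \<open>q\<close> start at \<open>y\<close> is contained in \<open>null\<close>.\<close>

lemma path_homotopy_from_nullhomotopy:
  assumes null: "loop_homotopic Y y (\<lambda>t. if t \<le> 1/2 then q (2 * t) else p (2 - 2 * t)) (\<lambda>_. y)"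
    and "p 1 = q 1"
  obtains h where "continuous_map (top_of_set ({0..1::real} \<times> {0..1::real})) Y h"
    "\<And>t. t \<in> {0..1} \<Longrightarrow> h (0, t) = p t \<and> h (1, t) = q t"
    "\<And>s. s \<in> {0..1::real} \<Longrightarrow> h (s, 0) = y \<and> h (s, 1) = p 1"
proof -
  have S: "prod_topology (top_of_set {0..1::real}) (top_of_set {0..1::real})
      = top_of_set ({0..1::real} \<times> {0..1::real})"
    by (simp add: prod_topology_subtopology flip: euclidean_product_topology)
       (simp add: subtopology_subtopology Times_Int_Times)
  let ?l = "\<lambda>t. if t \<le> 1/2 then q (2 * t) else p (2 - 2 * t)"
  obtain H where H: "continuous_map (top_of_set ({0..1::real} \<times> {0..1::real})) Y H"
      "\<And>t. t \<in> {0..1} \<Longrightarrow> H (0, t) = ?l t"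
      "\<And>t. t \<in> {0..1} \<Longrightarrow> H (1, t) = y"
      "\<And>s. s \<in> {0..1} \<Longrightarrow> H (s, 0) = y \<and> H (s, 1) = y"
    using null unfolding loop_homotopic_alt S by auto
  \<comment> \<open>\<open>c\<close> runs along the three sides of the unit square on which \<open>H\<close> is constant; the new homotopy
    reads \<open>H\<close> along the segments from \<open>c s\<close> to the midpoint of the remaining side.\<close>
  define c :: "real \<Rightarrow> real \<times> real"
    where "c s = (min 1 (min (3 * s) (3 - 3 * s)), max 0 (min 1 (2 - 3 * s)))" for s
  define \<phi> :: "real \<times> real \<Rightarrow> real \<times> real"
    where "\<phi> z = (1 - snd z) *\<^sub>R c (fst z) + snd z *\<^sub>R (0, 1/2)" for z
  have c_in: "c s \<in> {0..1::real} \<times> {0..1::real}" if "s \<in> {0..1}" for s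
    using that by (auto simp: c_def)
  have Hc: "H (c s) = y" if "s \<in> {0..1}" for s
  proof -
    consider "s \<le> 1/3" | "1/3 \<le> s" "s \<le> 2/3" | "2/3 \<le> s" by linarith
    then show ?thesis
    proof cases
      case 1
      then have "c s = (3 * s, 1)" using that by (auto simp: c_def)
      then show ?thesis using that 1 H(4)[of "3 * s"] by simp
    next
      case 2
      then have "c s = (1, 2 - 3 * s)" using that by (auto simp: c_def)
      then show ?thesis using 2 H(3)[of "2 - 3 * s"] by simp
    next
      case 3
      then have "c s = (3 - 3 * s, 0)" using that by (auto simp: c_def)
      then show ?thesis using that 3 H(4)[of "3 - 3 * s"] by simp
    qed
  qed
  have "\<phi> z \<in> {0..1::real} \<times> {0..1::real}" if "z \<in> {0..1::real} \<times> {0..1::real}" for z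
  proof -
    have "convex ({0..1::real} \<times> {0..1::real})" by (intro convex_Times convex_real_interval)
    then show ?thesis
      unfolding \<phi>_def using that c_in[of "fst z"]
      by (intro convexD_alt) (auto simp: mem_Times_iff)
  qed
  moreover have "continuous_on ({0..1::real} \<times> {0..1::real}) \<phi>"
    unfolding \<phi>_def c_def by (intro continuous_intros)
  ultimately have "continuous_map (top_of_set ({0..1::real} \<times> {0..1::real})) Y (H \<circ> \<phi>)"
    by (intro continuous_map_compose[OF _ H(1)]) auto
  moreover have "(H \<circ> \<phi>) (0, t) = p t \<and> (H \<circ> \<phi>) (1, t) = q t" if "t \<in> {0..1}" for t
  proof -
    \<comment> \<open>\<open>c 0\<close> and \<open>c 1\<close> are the corners
      \<open>(0, 1)\<close> and \<open>(0, 0)\<close>, so the first and last segments are the two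
      halves of the side carrying the loop. Read from the corners to the midpoint, these halves give
      \<open>p\<close> and \<open>q\<close>.\<close>
    have "\<phi> (0, t) = (0, 1 - t / 2)" "\<phi> (1, t) = (0, t / 2)"
      by (simp_all add: \<phi>_def c_def)
    moreover have "?l (1 - t / 2) = p t" "?l (t / 2) = q t"
      using that \<open>p 1 = q 1\<close> by auto
    ultimately show ?thesis using that H(2)[of "1 - t / 2"] H(2)[of "t / 2"] by simp
  qed
  moreover have "(H \<circ> \<phi>) (s, 0) = y \<and> (H \<circ> \<phi>) (s, 1) = p 1" if "s \<in> {0..1}" for s
    \<comment> \<open>All segments end at \<open>(0, 1/2)\<close>, where the loop has reached the
      common endpoint of \<open>q\<close> and \<open>p\<close>.\<close>
    using Hc[OF that] H(2)[of "1/2"] \<open>p 1 = q 1\<close> by (simp add: \<phi>_def flip: zero_prod_def)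
  ultimately show thesis using that by blast
qed

text \<open>Kept general in \<open>Z\<close> so that it can be applied in a small subspace, where
  the resulting loop is known to contract in \<open>Y\<close>.\<close>

lemma loop_at_out_and_back:
  assumes p: "pathin Z p" "p 0 = y" and q: "pathin Z q" "q 0 = y" and "p 1 = q 1"
  shows "loop_at Z y (\<lambda>t. if t \<le> 1/2 then q (2 * t) else p (2 - 2 * t))"
proof -
  let ?I = "top_of_set {0..1::real}"
  have half: "2 * t = 1 \<and> 2 - 2 * t = 1" if "t = 1/2" for t :: real
    using that by simp
  have "continuous_map ?I Z (\<lambda>t. if t \<le> 1/2 then (q \<circ> (\<lambda>t. 2 * t)) t else (p \<circ> (\<lambda>t. 2 - 2 * t)) t)"
  proof (rule continuous_map_cases_le)
    show "continuous_map (subtopology ?I {t \<in> topspace ?I. t \<le> 1/2}) Z (q \<circ> (\<lambda>t. 2 * t))"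
      by (rule continuous_map_compose[OF _ q(1)[unfolded pathin_def]])
         (auto simp: subtopology_subtopology intro!: continuous_intros)
    show "continuous_map (subtopology ?I {t \<in> topspace ?I. 1/2 \<le> t}) Z (p \<circ> (\<lambda>t. 2 - 2 * t))"
      by (rule continuous_map_compose[OF _ p(1)[unfolded pathin_def]])
         (auto simp: subtopology_subtopology intro!: continuous_intros)
  qed (auto simp: \<open>p 1 = q 1\<close> half intro!: continuous_intros)
  then show ?thesis
    using p q unfolding o_def by (simp add: loop_at_def pathin_def)
qed

section \<open>Small open sets with path-connected preimage\<close>

text \<open>\<open>N\<close> is the image of a path component \<open>D\<close> of the preimage of
  \<open>W\<close>. Local path-connectedness makes \<open>D\<close> open, connected fibers make it
  saturated, and then the quotient topology makes its image open with preimage exactly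
  \<open>D\<close>.\<close>

lemma quotient_map_path_connected_preimage:
  assumes f: "quotient_map X Y f" and X: "locally_path_connected_space X"
    and fib: "\<And>y. y \<in> topspace Y \<Longrightarrow> connectedin X {x \<in> topspace X. f x = y}"
    and W: "openin Y W" "y \<in> W"
  obtains N where "openin Y N" "y \<in> N" "N \<subseteq> W" "path_connectedin X {x \<in> topspace X. f x \<in> N}"
proof -
  define P where "P = {x \<in> topspace X. f x \<in> W}"
  define S where "S = subtopology X P"
  have im: "f ` topspace X = topspace Y"
    using f by (simp add: quotient_map_def)
  have WY: "W \<subseteq> topspace Y" using W openin_subset by blast
  have P: "openin X P"
    unfolding P_def using openin_continuous_map_preimage quotient_imp_continuous_map f W(1)
    by blast
  then have S: "locally_path_connected_space S" and tS: "topspace S = P"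
    unfolding S_def using X locally_path_connected_space_open_subset
    by (auto simp: P_def topspace_subtopology)
  have "y \<in> f ` topspace X" using W(2) WY unfolding im by (rule subsetD[rotated])
  then obtain x where x: "x \<in> topspace X" "f x = y" by auto
  define D where "D = path_component_of_set S x"
  have DP: "D \<subseteq> P" using path_component_of_subset_topspace[of S x] tS by (simp add: D_def)
  have "openin S D"
    unfolding D_def using S
    by (simp add: openin_path_component_of_locally_path_connected_space)
  then have D: "openin X D"
    using P by (simp add: S_def openin_open_subtopology)
  have xD: "x \<in> D"
    using x W tS by (auto simp: D_def P_def path_component_of_refl)
  \<comment> \<open>The whole fiber through \<open>d\<close> lies in \<open>P\<close>. Being
    connected, it stays in one component of \<open>S\<close>, and components of \<open>S\<close> are
    path components.\<close>
  have sat: "u \<in> D" if "u \<in> topspace X" "d \<in> D" "f u = f d" for u d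
  proof -
    let ?F = "{x \<in> topspace X. f x = f d}"
    have d: "d \<in> P" using that DP by blast
    then have "connectedin S ?F"
      using fib[of "f d"] WY by (auto simp: S_def connectedin_subtopology P_def)
    moreover have "u \<in> ?F" "d \<in> ?F" using that d by (auto simp: P_def)
    ultimately have "connected_component_of S d u"
      unfolding connected_component_of_def by blast
    then have "path_component_of S d u"
      using path_component_eq_connected_component_of[OF S, of d] by auto
    then show ?thesis
      using \<open>d \<in> D\<close> path_component_of_trans[of S x d u] by (simp add: D_def)
  qed
  have pre: "{u \<in> topspace X. f u \<in> f ` D} = D"
    using sat openin_subset[OF D] by auto
  show thesis
  proof
    show "openin Y (f ` D)"
    proof -
      have "f ` D \<subseteq> topspace Y" using openin_subset[OF D] im by blast
      then have "openin X {u \<in> topspace X. f u \<in> f ` D} \<longleftrightarrow> openin Y (f ` D)"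
        using f unfolding quotient_map_def by blast
      then show ?thesis using D unfolding pre by simp
    qed
    show "path_connectedin X {u \<in> topspace X. f u \<in> f ` D}"
      unfolding pre using path_connectedin_path_component_of[of S x]
      by (simp add: S_def D_def path_connectedin_subtopology)
    show "y \<in> f ` D" using x xD by blast
    show "f ` D \<subseteq> W" using DP by (auto simp: P_def)
  qed
qed

section \<open>Lifting short paths\<close>

text \<open>Any path \<delta> from \<open>x\<close> to \<open>x'\<close> in the preimage of
  \<open>N\<close> will do: its image and \<open>p\<close> lie in \<open>N\<close> and share their
  endpoints, so together they bound a loop in \<open>N\<close>, which contracts in
  \<open>Y\<close>.\<close>

lemma lift_small_path:
  assumes f: "continuous_map X Y f"
    and pc: "path_connectedin X {x \<in> topspace X. f x \<in> N}"
    and null: "\<And>p. loop_at (subtopology Y N) y p \<Longrightarrow> loop_homotopic Y y p (\<lambda>_. y)"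
    and p: "pathin (subtopology Y N) p" "p 0 = y"
    and x: "x \<in> topspace X" "f x = y" "x' \<in> topspace X" "f x' = p 1"
  obtains \<delta> h where "pathin X \<delta>" "\<delta> 0 = x" "\<delta> 1 = x'"
    "continuous_map (top_of_set ({0..1::real} \<times> {0..1::real})) Y h"
    "\<And>t. t \<in> {0..1} \<Longrightarrow> h (0, t) = p t \<and> h (1, t) = f (\<delta> t)"
    "\<And>s. s \<in> {0..1::real} \<Longrightarrow> h (s, 0) = p 0 \<and> h (s, 1) = p 1"
proof -
  let ?D = "{x \<in> topspace X. f x \<in> N}"
  have pN: "p t \<in> N" if "t \<in> {0..1}" for t
    using p(1) that by (auto simp: pathin_def continuous_map_in_subtopology)
  then have "x \<in> ?D" "x' \<in> ?D"
    using x p(2) pN[of 0] pN[of 1] by auto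
  then have "\<exists>\<delta>. pathin X \<delta> \<and> \<delta> \<in> {0..1} \<rightarrow> ?D \<and> \<delta> 0 = x \<and> \<delta> 1 = x'"
    using pc unfolding path_connectedin by simp
  then obtain \<delta> where \<delta>: "pathin X \<delta>" "\<delta> \<in> {0..1} \<rightarrow> ?D" "\<delta> 0 = x" "\<delta> 1 = x'"
    by auto
  have "pathin (subtopology Y N) (f \<circ> \<delta>)"
    using continuous_map_compose[OF \<delta>(1)[unfolded pathin_def] f] \<delta>(2)
    by (auto simp: pathin_def continuous_map_in_subtopology)
  then have "loop_homotopic Y y (\<lambda>t. if t \<le> 1/2 then (f \<circ> \<delta>) (2 * t) else p (2 - 2 * t)) (\<lambda>_. y)"
    by (intro null loop_at_out_and_back) (use p x \<delta> in \<open>simp_all add: o_def\<close>)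
  then obtain h where "continuous_map (top_of_set ({0..1::real} \<times> {0..1::real})) Y h"
    "\<And>t. t \<in> {0..1} \<Longrightarrow> h (0, t) = p t \<and> h (1, t) = (f \<circ> \<delta>) t"
    "\<And>s. s \<in> {0..1::real} \<Longrightarrow> h (s, 0) = y \<and> h (s, 1) = p 1"
    by (rule path_homotopy_from_nullhomotopy) (use \<delta> x in auto)
  then show thesis
    using that[of \<delta> h] \<delta> p(2) by simp
qed

text \<open>Loops are known to contract only at the base point \<open>y\<close>, so \<open>g\<close>
  must be traversed starting from an end where it takes the value \<open>y\<close>, which may mean
  backwards.\<close>

lemma lifts_rel_endpoints_small:
  assumes f: "continuous_map X Y f"
    and pc: "path_connectedin X {x \<in> topspace X. f x \<in> N}"
    and null: "\<And>p. loop_at (subtopology Y N) y p \<Longrightarrow> loop_homotopic Y y p (\<lambda>_. y)"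
    and g: "continuous_map (top_of_set {a..b}) (subtopology Y N) g"
    and ab: "a < b" "g a = y \<or> g b = y"
    and x: "x \<in> topspace X" "f x = g a" "x' \<in> topspace X" "f x' = g b"
  shows "lifts_rel_endpoints X Y f g a b x x'"
proof -
  \<comment> \<open>\<open>v\<close> parametrizes \<open>{a..b}\<close> starting at the end
    \<open>v0\<close> over which \<open>g\<close> is \<open>y\<close>, and \<open>u\<close> undoes
    it. The points \<open>z\<close> and \<open>z'\<close> are \<open>x\<close> and \<open>x'\<close>
    in the order of traversal.\<close>
  have reparam: "lifts_rel_endpoints X Y f g a b x x'"
    if v: "continuous_on {0..1} v" "v ` {0..1} \<subseteq> {a..b}" "v 0 = v0" "g v0 = y"
      and u: "continuous_on {a..b} u" "u ` {a..b} \<subseteq> {0..1}"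
        "\<And>t. t \<in> {a..b} \<Longrightarrow> v (u t) = t"
      and e: "u a = 0 \<and> u b = 1 \<and> z = x \<and> z' = x' \<or> u a = 1 \<and> u b = 0 \<and> z = x' \<and> z' = x"
    for u v :: "real \<Rightarrow> real" and v0 z z'
  proof -
    have ve: "v (u a) = a" "v (u b) = b" using u(3) ab by auto
    have "pathin (subtopology Y N) (g \<circ> v)"
      unfolding pathin_def by (rule continuous_map_compose[OF _ g]) (use v in auto)
    moreover have "(g \<circ> v) 0 = y" "f z = y" "f z' = (g \<circ> v) 1" "z \<in> topspace X" "z' \<in> topspace X"
      using v e x ve by auto
    ultimately obtain \<delta> h where \<delta>: "pathin X \<delta>" "\<delta> 0 = z" "\<delta> 1 = z'"
      and h: "continuous_map (top_of_set ({0..1::real} \<times> {0..1::real})) Y h"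
        "\<And>t. t \<in> {0..1} \<Longrightarrow> h (0, t) = (g \<circ> v) t \<and> h (1, t) = f (\<delta> t)"
        "\<And>s. s \<in> {0..1::real} \<Longrightarrow> h (s, 0) = (g \<circ> v) 0 \<and> h (s, 1) = (g \<circ> v) 1"
      using lift_small_path[OF f pc null, of "g \<circ> v" z z'] by blast
    have "continuous_map (top_of_set {a..b}) X (\<delta> \<circ> u)"
      by (rule continuous_map_compose[OF _ \<delta>(1)[unfolded pathin_def]]) (use u in auto)
    moreover have "continuous_map (top_of_set ({0..1::real} \<times> {a..b})) Y (h \<circ> (\<lambda>z. (fst z, u (snd z))))"
      by (rule continuous_map_compose[OF _ h(1)])
         (use u in \<open>auto intro!: continuous_intros continuous_on_compose2[OF u(1)]\<close>)
    moreover have "(\<delta> \<circ> u) a = x" "(\<delta> \<circ> u) b = x'"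
      using e \<delta> by auto
    moreover have "\<forall>t\<in>{a..b}. (h \<circ> (\<lambda>z. (fst z, u (snd z)))) (0, t) = g t
        \<and> (h \<circ> (\<lambda>z. (fst z, u (snd z)))) (1, t) = f ((\<delta> \<circ> u) t)"
      using h(2) u by (auto simp: image_subset_iff)
    moreover have "\<forall>s\<in>{0..1}. (h \<circ> (\<lambda>z. (fst z, u (snd z)))) (s, a) = g a
        \<and> (h \<circ> (\<lambda>z. (fst z, u (snd z)))) (s, b) = g b"
      using h(3) e ve by auto
    ultimately show ?thesis
      unfolding lifts_rel_endpoints_def by blast
  qed
  have bounds: "0 \<le> r * (b - a)" "r * (b - a) \<le> b - a" if "0 \<le> r" "r \<le> 1" for r
    using that ab by (auto simp: mult_left_le_one_le)
  from ab(2) show ?thesis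
  proof
    assume "g a = y"
    then show ?thesis
      using ab bounds
      by (intro reparam[of "\<lambda>r. a + r * (b - a)" a "\<lambda>t. (t - a) / (b - a)" x x'])
         (auto intro!: continuous_intros simp: divide_le_eq le_diff_eq add.commute)
  next
    assume "g b = y"
    then show ?thesis
      using ab bounds
      \<comment> \<open>Here the segment is run from \<open>b\<close> to \<open>a\<close>, so the
        lift starts at \<open>x'\<close>.\<close>
      by (intro reparam[of "\<lambda>r. b - r * (b - a)" b "\<lambda>t. (b - t) / (b - a)" x' x])
         (auto intro!: continuous_intros simp: divide_le_eq le_diff_eq add.commute)
  qed
qed

section \<open>Subdivision and lifting of whole paths\<close>

text \<open>The good neighbourhood is based at \<open>g t\<close>, so a short interval around
  \<open>t\<close> is cut at \<open>t\<close> to make \<open>t\<close> an endpoint of each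
  piece.\<close>

lemma lifts_rel_endpoints_local:
  assumes f: "quotient_map X Y f" and X: "locally_path_connected_space X"
    and Y: "semilocally_simply_connected Y"
    and fib: "\<And>y. y \<in> topspace Y \<Longrightarrow> connectedin X {x \<in> topspace X. f x = y}"
    and g: "pathin Y g" and t: "t \<in> {0..1}"
  shows "\<exists>d>0. \<forall>a b x x'. 0 \<le> a \<and> a \<le> t \<and> t \<le> b \<and> b \<le> 1 \<and> b - a < d \<and> a < b \<and>
    x \<in> topspace X \<and> f x = g a \<and> x' \<in> topspace X \<and> f x' = g b
    \<longrightarrow> lifts_rel_endpoints X Y f g a b x x'"
proof -
  have cont: "continuous_map X Y f" using f by (rule quotient_imp_continuous_map)
  have gY: "g t \<in> topspace Y"
    using g t by (auto simp: pathin_def continuous_map_def Pi_iff)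
  obtain W where W: "openin Y W" "g t \<in> W"
    and nullW: "\<And>p. loop_at (subtopology Y W) (g t) p \<Longrightarrow> loop_homotopic Y (g t) p (\<lambda>_. g t)"
    using semilocally_simply_connected_nullhomotopic[OF Y gY] by blast
  obtain N where N: "openin Y N" "g t \<in> N" "N \<subseteq> W"
    and pc: "path_connectedin X {x \<in> topspace X. f x \<in> N}"
    using quotient_map_path_connected_preimage[OF f X fib W] by blast
  have null: "loop_homotopic Y (g t) p (\<lambda>_. g t)" if "loop_at (subtopology Y N) (g t) p" for p
    using that N(3) by (intro nullW) (auto simp: loop_at_def pathin_def continuous_map_in_subtopology)
  have "openin (top_of_set {0..1}) {r \<in> {0..1}. g r \<in> N}"
    using openin_continuous_map_preimage[OF g[unfolded pathin_def] N(1)] by simp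
  then obtain d where d: "d > 0" "\<And>r. r \<in> {0..1} \<Longrightarrow> dist r t < d \<Longrightarrow> g r \<in> N"
    using t N(2) unfolding openin_euclidean_subtopology_iff by blast
  have sub: "lifts_rel_endpoints X Y f g a b x x'"
    if "0 \<le> a" "a < b" "b \<le> 1" "b - a < d" "a \<le> t" "t \<le> b" "a = t \<or> b = t"
      "x \<in> topspace X" "f x = g a" "x' \<in> topspace X" "f x' = g b" for a b x x'
  proof (rule lifts_rel_endpoints_small[OF cont pc null])
    have "continuous_map (top_of_set {a..b}) Y g"
      using continuous_map_from_subtopology_mono[of "euclideanreal" "{0..1}" Y g "{a..b}"] g that(1,3)
      by (auto simp: pathin_def)
    moreover have "g r \<in> N" if "r \<in> {a..b}" for r
      using that \<open>0 \<le> a\<close> \<open>b \<le> 1\<close> \<open>b - a < d\<close> \<open>a \<le> t\<close> \<open>t \<le> b\<close> by (intro d(2)) (auto simp: dist_real_def)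
    ultimately show "continuous_map (top_of_set {a..b}) (subtopology Y N) g"
      by (auto simp: continuous_map_in_subtopology)
  qed (use that in auto)
  \<comment> \<open>Any point over \<open>g t\<close> can serve as the junction, since the endpoints
    of each lift may be prescribed.\<close>
  obtain z where z: "z \<in> topspace X" "f z = g t"
    using gY by (auto simp flip: quotient_imp_surjective_map[OF f])
  have "lifts_rel_endpoints X Y f g a b x x'"
    if "0 \<le> a" "a \<le> t" "t \<le> b" "b \<le> 1" "b - a < d" "a < b"
      "x \<in> topspace X" "f x = g a" "x' \<in> topspace X" "f x' = g b" for a b x x'
  proof (cases "a = t \<or> b = t")
    case True
    then show ?thesis using that by (intro sub) auto
  next
    case False
    then have "lifts_rel_endpoints X Y f g a t x z" "lifts_rel_endpoints X Y f g t b z x'"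
      using that z by (auto intro!: sub)
    then show ?thesis
      using that by (intro lifts_rel_endpoints_trans[of a t b])
  qed
  then show ?thesis using d(1) by blast
qed

text \<open>Bisection: liftability for all choices of endpoints passes from two adjacent intervals
  to their union and holds on all short intervals around each point, hence on the unit
  interval.\<close>

lemma quotient_map_lifts_path:
  assumes f: "quotient_map X Y f" and X: "locally_path_connected_space X"
    and Y: "semilocally_simply_connected Y"
    and fib: "\<And>y. y \<in> topspace Y \<Longrightarrow> connectedin X {x \<in> topspace X. f x = y}"
    and g: "pathin Y g"
    and x: "x \<in> topspace X" "f x = g 0" "x' \<in> topspace X" "f x' = g 1"
  shows "lifts_rel_endpoints X Y f g 0 1 x x'"
proof -
  \<comment> \<open>Degenerate intervals are excluded, as there the two endpoints need not coincide.\<close>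
  define Q where "Q a b \<longleftrightarrow> (0 \<le> a \<and> a < b \<and> b \<le> 1 \<longrightarrow> (\<forall>x x'. x \<in> topspace X \<and> f x = g a \<and>
    x' \<in> topspace X \<and> f x' = g b \<longrightarrow> lifts_rel_endpoints X Y f g a b x x'))" for a b
  have "Q 0 1"
  proof (rule Bolzano)
    fix a b c :: real assume *: "Q a b" "Q b c" "a \<le> b" "b \<le> c"
    show "Q a c"
    proof (cases "a = b \<or> b = c")
      case False
      show ?thesis
        unfolding Q_def
      proof (intro impI allI)
        fix x x'
        assume ac: "0 \<le> a \<and> a < c \<and> c \<le> 1"
          and xx': "x \<in> topspace X \<and> f x = g a \<and> x' \<in> topspace X \<and> f x' = g c"
        have "g b \<in> topspace Y"
          using g ac * by (auto simp: pathin_def continuous_map_def Pi_iff)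
        \<comment> \<open>An arbitrary junction suffices because \<open>Q\<close> quantifies over
          all endpoints in the fibers.\<close>
        then obtain z where z: "z \<in> topspace X" "f z = g b"
          by (auto simp flip: quotient_imp_surjective_map[OF f])
        have "lifts_rel_endpoints X Y f g a b x z" "lifts_rel_endpoints X Y f g b c z x'"
          using * False ac xx' z unfolding Q_def by auto
        then show "lifts_rel_endpoints X Y f g a c x x'"
          using * by (intro lifts_rel_endpoints_trans[of a b c])
      qed
    qed (use * in auto)
  next
    fix t :: real assume "0 \<le> t" "t \<le> 1"
    then have "t \<in> {0..1}" by simp
    from lifts_rel_endpoints_local[OF f X Y fib g this]
    obtain d where "d > 0" and d: "\<And>a b x x'. 0 \<le> a \<and> a \<le> t \<and> t \<le> b \<and> b \<le> 1 \<and>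
        b - a < d \<and> a < b \<and> x \<in> topspace X \<and> f x = g a \<and> x' \<in> topspace X \<and> f x' = g b
        \<Longrightarrow> lifts_rel_endpoints X Y f g a b x x'"
      by auto
    \<comment> \<open>The intervals in \<open>Bolzano\<close> may leave the unit interval or be
      degenerate; there \<open>Q\<close> holds vacuously.\<close>
    then show "\<exists>d>0. \<forall>a b. a \<le> t \<and> t \<le> b \<and> b - a < d \<longrightarrow> Q a b"
      unfolding Q_def by (intro exI[of _ d]) (simp add: d)
  qed simp
  then show ?thesis using x by (simp add: Q_def)
qed

theorem theorem1p1:
  fixes X :: "'a topology" and Y :: "'b topology" and f :: "'a \<Rightarrow> 'b"
    and x0 :: 'a and y0 :: 'b
  assumes "x0 \<in> topspace X"
    and "f x0 = y0"
    and "quotient_map X Y f"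
    and "locally_path_connected_space X"
    and "semilocally_simply_connected Y"
    and "\<And>y. y \<in> topspace Y \<Longrightarrow> connectedin X {x \<in> topspace X. f x = y}"
  shows "fundamental_group_map Y y0 f
           \<in> epi (fundamental_group X x0) (fundamental_group Y y0)"
proof -
  have f: "continuous_map X Y f" using assms(3) by (rule quotient_imp_continuous_map)
  have hom: "fundamental_group_map Y y0 f \<in> hom (fundamental_group X x0) (fundamental_group Y y0)"
    using fundamental_group_map_hom[OF f, of x0] assms(2) by simp
  have "\<exists>p. loop_at X x0 p \<and> fundamental_group_map Y y0 f (loop_class X x0 p) = loop_class Y y0 g"
    if g: "loop_at Y y0 g" for g
  proof -
    have S: "prod_topology (top_of_set {0..1::real}) (top_of_set {0..1::real})
        = top_of_set ({0..1::real} \<times> {0..1::real})"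
      by (simp add: prod_topology_subtopology flip: euclidean_product_topology)
         (simp add: subtopology_subtopology Times_Int_Times)
    \<comment> \<open>Since \<open>x0\<close> lies over both ends of \<open>g\<close>, it can be
      prescribed at both ends of the lift, which is therefore a loop.\<close>
    have "lifts_rel_endpoints X Y f g 0 1 x0 x0"
      using g assms by (intro quotient_map_lifts_path) (auto simp: loop_at_def)
    then obtain p h where p: "loop_at X x0 p"
      and h: "continuous_map (top_of_set ({0..1::real} \<times> {0..1::real})) Y h"
        "\<forall>t\<in>{0..1}. h (0, t) = g t \<and> h (1, t) = f (p t)"
        "\<forall>s\<in>{0..1}. h (s, 0) = g 0 \<and> h (s, 1) = g 1"
      unfolding lifts_rel_endpoints_def loop_at_def pathin_def by blast
    have "loop_homotopic Y y0 g (f \<circ> p)"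
      unfolding loop_homotopic_alt S using h g by (intro exI[of _ h]) (auto simp: loop_at_def)
    then have "loop_class Y y0 (f \<circ> p) = loop_class Y y0 g"
      using loop_class_eq by metis
    then show ?thesis
      using p fundamental_group_map_class[OF f p] assms(2) by auto
  qed
  then have "carrier (fundamental_group Y y0)
      \<subseteq> fundamental_group_map Y y0 f ` carrier (fundamental_group X x0)"
    by (force simp: fundamental_group_def)
  then show ?thesis
    using hom unfolding epi_def by (auto simp: hom_def)
qed

end
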